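(* Let $b\geq 2$ and $n\geq 1$ be integers, and let $d=\gcd(b-1,n)$. Then the following statements hold. (i) $\mathrm{Out}(s_b,n)\subseteq \{u\in\mathbb{N} \mid u\equiv 0 \pmod{d}\}$. (ii) $\mathrm{Out}(s_b,n)$ is a cofinite subset of $\mathbb{N}$ if and only if $d=1$.
   Context: $\mathbb{N}$ denotes the set of positive integers. For an integer $b\geq 2$ and a positive integer $N$ with base-$b$ expansion $N=\sum_{i=0}^k a_i b^i$, where $a_k\neq 0$ and $0\leq a_i<b$ for all $i$, the sum of digits of $N$ in base $b$ is $s_b(N)=a_0+a_1+\cdots+a_k$. For an arithmetic function $g$ and $n\in\mathbb{N}$, $\mathrm{Out}(g,n)$ is the set of all $u\in\mathbb{N}$ for which there exists a positive integer $N$ such that $n\mid N$ and $g(N)=u$. A subset of $\mathbb{N}$ is cofinite if its complement in $\mathbb{N}$ is finite. *)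

theory Defs
  imports "HOL-Number_Theory.Cong"
begin

definition base_expansion :: "nat \<Rightarrow> nat \<Rightarrow> nat \<Rightarrow> (nat \<Rightarrow> nat) \<Rightarrow> bool" where
  "base_expansion b N k a \<longleftrightarrow>
     N = (\<Sum>i\<le>k. a i * b ^ i) \<and> a k \<noteq> 0 \<and> (\<forall>i\<le>k. a i < b)"

text \<open>For \<open>b \<ge> 2\<close> and \<open>N > 0\<close> the expansion exists and is unique (\<open>base_expansion_exists\<close>,
  \<open>base_expansion_unique\<close>); at all other arguments the value of \<open>digit_sum\<close> is immaterial.\<close>

definition digit_sum :: "nat \<Rightarrow> nat \<Rightarrow> nat" where
  "digit_sum b N = (THE s. \<exists>k a. base_expansion b N k a \<and> s = (\<Sum>i\<le>k. a i))"

text \<open>The positive integers are represented by the set \<open>{1..}\<close> of type \<^typ>\<open>nat set\<close>.\<close>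

definition Out :: "(nat \<Rightarrow> nat) \<Rightarrow> nat \<Rightarrow> nat set" where
  "Out g n = {u \<in> {1..}. \<exists>N\<in>{1..}. n dvd N \<and> g N = u}"

definition cofinite_pos :: "nat set \<Rightarrow> bool" where
  "cofinite_pos S \<longleftrightarrow> S \<subseteq> {1..} \<and> finite ({1..} - S)"

lemma base_expansion_0:
  "base_expansion b N 0 a \<longleftrightarrow> N = a 0 \<and> N \<noteq> 0 \<and> N < b"
  by (auto simp: base_expansion_def)

lemma base_expansion_Suc:
  "base_expansion b N (Suc k) a \<longleftrightarrow>
     a 0 < b \<and> N mod b = a 0 \<and> base_expansion b (N div b) k (\<lambda>i. a (Suc i))"
proof -
  have s: "(\<Sum>i\<le>Suc k. a i * b ^ i) = a 0 + b * (\<Sum>i\<le>k. a (Suc i) * b ^ i)"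
    by (subst sum.atMost_Suc_shift) (simp add: sum_distrib_left algebra_simps)
  have q: "(\<forall>i\<le>Suc k. a i < b) \<longleftrightarrow> a 0 < b \<and> (\<forall>i\<le>k. a (Suc i) < b)"
    by (metis Suc_le_mono le0 not0_implies_Suc)
  have e: "N = a 0 + b * M \<longleftrightarrow> N mod b = a 0 \<and> N div b = M" if "a 0 < b" for M
    using that by (metis add.commute div_less div_mult_self2 gr_implies_not0 mod_less
        mod_mult_self2 mult_div_mod_eq add.left_neutral)
  show ?thesis
    unfolding base_expansion_def s q using e by blast
qed

lemma base_expansion_pos: "base_expansion b N k a \<Longrightarrow> N > 0"
proof (induction k arbitrary: N a)
  case 0
  then show ?case by (simp add: base_expansion_0)
next
  case (Suc k)
  then have "N div b > 0" by (auto simp: base_expansion_Suc)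
  then show ?case by (metis div_0 gr0I)
qed

lemma base_expansion_exists:
  assumes "b \<ge> 2" "N > 0"
  shows "\<exists>k a. base_expansion b N k a"
  using assms(2)
proof (induction N rule: less_induct)
  case (less N)
  show ?case
  proof (cases "N < b")
    case True
    then have "base_expansion b N 0 (\<lambda>_. N)"
      using less.prems by (simp add: base_expansion_0)
    then show ?thesis by blast
  next
    case False
    have "N div b < N" "0 < N div b"
      using assms(1) less.prems False by (auto simp: div_greater_zero_iff)
    then obtain k a where "base_expansion b (N div b) k a"
      using less.IH by blast
    then have "base_expansion b N (Suc k) (case_nat (N mod b) a)"
      using assms(1) by (simp add: base_expansion_Suc)
    then show ?thesis by blast
  qed
qed

lemma base_expansion_unique:
  assumes "base_expansion b N k a" "base_expansion b N l c"
  shows "k = l \<and> (\<forall>i\<le>k. a i = c i)"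
  using assms
proof (induction k arbitrary: N a l c)
  case 0
  show ?case
  proof (cases l)
    case 0
    then show ?thesis using "0.prems" by (simp add: base_expansion_0)
  next
    case (Suc m)
    then have "N div b > 0"
      using "0.prems"(2) base_expansion_pos by (auto simp: base_expansion_Suc)
    then show ?thesis using "0.prems"(1) by (simp add: base_expansion_0)
  qed
next
  case (Suc k)
  have a: "N mod b = a 0" "base_expansion b (N div b) k (\<lambda>i. a (Suc i))"
    using Suc.prems(1) by (auto simp: base_expansion_Suc)
  obtain m where m: "l = Suc m"
  proof (cases l)
    case 0
    then show ?thesis
      using Suc.prems(2) base_expansion_pos[OF a(2)] by (simp add: base_expansion_0)
  qed blast
  have c: "N mod b = c 0" "base_expansion b (N div b) m (\<lambda>i. c (Suc i))"
    using Suc.prems(2) m by (auto simp: base_expansion_Suc)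
  have "k = m \<and> (\<forall>i\<le>k. a (Suc i) = c (Suc i))"
    using Suc.IH[OF a(2) c(2)] .
  then show ?case
    using a(1) c(1) m by (metis Suc_le_mono not0_implies_Suc)
qed

lemma digit_sum_eq:
  assumes "base_expansion b N k a"
  shows "digit_sum b N = (\<Sum>i\<le>k. a i)"
  unfolding digit_sum_def
proof (rule the_equality)
  show "\<exists>l c. base_expansion b N l c \<and> (\<Sum>i\<le>k. a i) = (\<Sum>i\<le>l. c i)"
    using assms by blast
next
  fix s
  assume "\<exists>l c. base_expansion b N l c \<and> s = (\<Sum>i\<le>l. c i)"
  then obtain l c where lc: "base_expansion b N l c" "s = (\<Sum>i\<le>l. c i)"
    by blast
  then show "s = (\<Sum>i\<le>k. a i)"
    using base_expansion_unique[OF assms lc(1)] by simp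
qed

end

theory Submission
  imports Defs
begin

text \<open>Modulo \<open>b - 1\<close> every power of \<open>b\<close> is \<open>1\<close>, so \<open>N\<close> is congruent to its digit sum modulo \<open>d\<close>;
  this gives (i), and a cofinite set contains two consecutive integers, so cofiniteness forces
  \<open>d = 1\<close>. Conversely, by the pigeonhole principle \<open>b ^ i\<close> has a constant residue \<open>c\<close> modulo \<open>n\<close> for
  infinitely many \<open>i\<close>. Add \<open>u - q\<close> such powers and \<open>b\<close> times \<open>q\<close> further ones, with all exponents
  distinct: the digit sum is \<open>u\<close> and the residue is \<open>c * (u + q * (b - 1))\<close>. If \<open>b - 1\<close> is
  invertible modulo \<open>n\<close>, some \<open>q < n\<close> makes it vanish, so every \<open>u \<ge> n\<close> is attained.\<close>

lemma digit_sum_cong: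
  assumes "b \<ge> 2" "N > 0" "d dvd b - 1"
  shows "[N = digit_sum b N] (mod d)"
proof -
  obtain k a where e: "base_expansion b N k a"
    using base_expansion_exists assms by blast
  have b1: "[b = 1] (mod d)"
    using assms by (simp add: cong_altdef_nat)
  have "[a i * b ^ i = a i] (mod d)" for i
    using cong_scalar_left[OF cong_pow[OF b1], of "a i" i] by simp
  then have "[(\<Sum>i\<le>k. a i * b ^ i) = (\<Sum>i\<le>k. a i)] (mod d)"
    by (intro cong_sum)
  then show ?thesis
    using e digit_sum_eq[OF e] by (simp add: base_expansion_def)
qed

text \<open>Since \<open>b\<close> is at least 2, the indicator function of \<open>S\<close> is a
  legal digit sequence, with leading digit 1 at position \<open>Max S\<close>.\<close>

lemma digit_sum_sum_distinct_powers:
  assumes "b \<ge> 2" "finite S" "S \<noteq> {}"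
  shows "digit_sum b (\<Sum>i\<in>S. b ^ i) = card S"
proof -
  define a :: "nat \<Rightarrow> nat" where "a i = of_bool (i \<in> S)" for i
  \<comment> \<open>Kept general in \<open>f\<close>: powers of \<open>b\<close> give the value of
    the expansion, the constant 1 its digit sum.\<close>
  have sum_a: "(\<Sum>i\<le>Max S. a i * f i) = sum f S" for f
  proof -
    have "(\<Sum>i\<le>Max S. a i * f i) = (\<Sum>i\<in>S. a i * f i)"
      using assms by (intro sum.mono_neutral_right) (auto simp: a_def)
    also have "\<dots> = sum f S"
      by (simp add: a_def)
    finally show ?thesis .
  qed
  have "base_expansion b (\<Sum>i\<in>S. b ^ i) (Max S) a"
    using assms by (simp add: base_expansion_def sum_a) (simp add: a_def)
  from digit_sum_eq[OF this] show ?thesis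
    using sum_a[of "\<lambda>_. 1"] by simp
qed

lemma infinite_const_power_residue:
  fixes b n :: nat
  assumes "n \<ge> 1"
  obtains A c where "infinite A" "\<And>i. i \<in> A \<Longrightarrow> [b ^ i = c] (mod n)"
proof -
  have "finite (range (\<lambda>i. b ^ i mod n))"
    by (rule finite_subset[of _ "{..<n}"]) (use assms in auto)
  then obtain i where "infinite {j \<in> UNIV. b ^ j mod n = b ^ i mod n}"
    using pigeonhole_infinite[of "UNIV :: nat set" "\<lambda>i. b ^ i mod n"] by auto
  then show thesis
    by (rule that) (simp add: cong_def)
qed

lemma ex_shift_dvd:
  fixes m n u :: nat
  assumes "n \<ge> 1" "coprime m n"
  obtains q where "q < n" "n dvd u + q * m"
proof -
  obtain x where x: "[m * x = 1] (mod n)"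
    using cong_solve_coprime_nat[OF assms(2)] by auto
  \<comment> \<open>\<open>x\<close> inverts \<open>m\<close> modulo \<open>n\<close>, and
    \<open>(n - 1) * u\<close> stands for \<open>-u\<close> within the naturals; reducing
    \<open>y\<close> modulo \<open>n\<close> yields the bound \<open>q < n\<close>.\<close>
  define y where "y = x * ((n - 1) * u)"
  have "[u + (y mod n) * m = u + y * m] (mod n)"
    by (rule cong_add[OF cong_refl cong_scalar_right]) (simp add: cong_def)
  also have "u + y * m = u + (m * x) * ((n - 1) * u)"
    by (simp add: y_def algebra_simps)
  also have "[\<dots> = u + 1 * ((n - 1) * u)] (mod n)"
    by (rule cong_add[OF cong_refl cong_scalar_right[OF x]])
  also have "u + 1 * ((n - 1) * u) = n * u"
    using assms(1) by (simp add: algebra_simps)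
  finally have "n dvd u + (y mod n) * m"
    by (simp add: cong_dvd_iff)
  then show thesis
    using that[of "y mod n"] assms(1) by simp
qed

lemma mem_Out_digit_sum:
  assumes b: "b \<ge> 2" and n: "n \<ge> 1" and cop: "coprime (b - 1) n" and u: "u \<ge> n"
  shows "u \<in> Out (digit_sum b) n"
proof -
  obtain q where q: "q < n" "n dvd u + q * (b - 1)"
    using ex_shift_dvd[OF n cop] by blast
  obtain A c where A: "infinite A" "\<And>i. i \<in> A \<Longrightarrow> [b ^ i = c] (mod n)"
    using infinite_const_power_residue[OF n] by blast
  obtain T where T: "T \<subseteq> A" "finite T" "card T = q"
    using infinite_arbitrarily_large[OF A(1)] by blast
  \<comment> \<open>Shifting the exponents in \<open>T\<close> by one gives each residue
    \<open>b * c\<close>. This blocks only finitely many positions, so \<open>R\<close> can avoid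
    them and no digit exceeds 1.\<close>
  have inf: "infinite (A - Suc ` T)"
    using A(1) T(2) by (simp add: Diff_infinite_finite)
  obtain R where R: "finite R" "card R = u - q" "R \<subseteq> A - Suc ` T"
    using infinite_arbitrarily_large[OF inf, of "u - q"] by auto
  define N where "N = (\<Sum>i\<in>R \<union> Suc ` T. b ^ i)"
  have disj: "R \<inter> Suc ` T = {}"
    using R by blast
  have card: "card (R \<union> Suc ` T) = u"
    using disj R T q(1) u by (simp add: card_Un_disjoint card_image)
  have ne: "R \<union> Suc ` T \<noteq> {}"
    using card n u by auto
  have "N = (\<Sum>i\<in>R. b ^ i) + (\<Sum>i\<in>T. b * b ^ i)"
    unfolding N_def using disj R T by (simp add: sum.union_disjoint sum.reindex)
  also have "[\<dots> = (\<Sum>i\<in>R. c) + (\<Sum>i\<in>T. b * c)] (mod n)"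
    using R T A(2) by (intro cong_add cong_sum cong_scalar_left) auto
  also have "(\<Sum>i\<in>R. c) + (\<Sum>i\<in>T. b * c) = c * ((u - q) + q * b)"
    using R T by (simp add: algebra_simps)
  \<comment> \<open>No subtraction truncates here, because \<open>q < n\<close>,
    \<open>n \<le> u\<close> and \<open>b \<ge> 2\<close>.\<close>
  also have "(u - q) + q * b = u + q * (b - 1)"
    using q u b by (simp add: algebra_simps)
  finally have "n dvd N"
    using q(2) by (simp add: cong_dvd_iff)
  moreover have "N > 0"
    unfolding N_def using R T ne b by (intro sum_pos) auto
  moreover have "digit_sum b N = u"
    unfolding N_def using digit_sum_sum_distinct_powers[OF b _ ne] R(1) T(2) card by simp
  ultimately have "\<exists>N\<in>{1..}. n dvd N \<and> digit_sum b N = u"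
    by (intro bexI[of _ N]) simp_all
  then show ?thesis
    using n u by (simp add: Out_def)
qed

theorem theorem1:
  fixes b n d :: nat
  assumes "b \<ge> 2" and "n \<ge> 1" and "d = gcd (b - 1) n"
  shows "Out (digit_sum b) n \<subseteq> {u \<in> {1..}. [u = 0] (mod d)} \<and>
    (cofinite_pos (Out (digit_sum b) n) \<longleftrightarrow> d = 1)"
proof
  let ?O = "Out (digit_sum b) n"
  show sub: "?O \<subseteq> {u \<in> {1..}. [u = 0] (mod d)}"
  proof
    fix u assume "u \<in> ?O"
    then have "u \<ge> 1" "\<exists>N>0. n dvd N \<and> digit_sum b N = u"
      by (auto simp: Out_def Suc_le_eq)
    then obtain N where N: "u \<ge> 1" "N > 0" "n dvd N" "digit_sum b N = u"
      by blast
    have "[N = u] (mod d)"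
      using digit_sum_cong[OF assms(1) N(2)] N(4) assms(3) by auto
    moreover have "d dvd N"
      using N(3) assms(3) dvd_trans gcd_dvd2 by blast
    ultimately show "u \<in> {u \<in> {1..}. [u = 0] (mod d)}"
      using N(1) by (simp add: cong_0_iff cong_dvd_iff)
  qed
  show "cofinite_pos ?O \<longleftrightarrow> d = 1"
  proof
    assume "cofinite_pos ?O"
    \<comment> \<open>\<open>m\<close> bounds the finite complement, so its two successors are both
      attained and differ by 1.\<close>
    then obtain m where m: "\<And>u. u \<in> {1..} - ?O \<Longrightarrow> u \<le> m"
      unfolding cofinite_pos_def finite_nat_set_iff_bounded_le by blast
    have "u \<in> ?O" if "u > m" for u
      using m[of u] that by (cases "u \<in> ?O") auto
    then have "Suc m \<in> ?O" "Suc (Suc m) \<in> ?O"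
      by simp_all
    then have "d dvd Suc m" "d dvd Suc m + 1"
      using sub by (auto simp: cong_0_iff)
    then show "d = 1"
      using dvd_add_right_iff[of d "Suc m" 1] by simp
  next
    assume "d = 1"
    then have "coprime (b - 1) n"
      using assms(3) by (simp add: coprime_iff_gcd_eq_1)
    then have "{1..} - ?O \<subseteq> {..<n}"
      using mem_Out_digit_sum[OF assms(1,2)] by (meson DiffD2 lessThan_iff not_le subsetI)
    then have "finite ({1..} - ?O)"
      by (rule finite_subset) simp
    then show "cofinite_pos ?O"
      by (auto simp: cofinite_pos_def Out_def)
  qed
qed

end
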